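(* Any cluster algebra with principal coefficients is prime gluing free.
   Context: Ice quivers. An ice quiver is a finite quiver $Q$ (no loops, no 2-cycles) with vertex set $\{1,\dots,n+m\}$ and a subset $\{n+1,\dots,n+m\}$ of frozen vertices ($m=0$ allowed); the vertices $1,\dots,n$ are exchangeable; there are no arrows between frozen vertices. The principal part is the full subquiver on the exchangeable vertices. Standing assumption: an ice quiver and its principal part are connected. The exchange matrix is $B=(b_{ji})$, of size $(n+m)\times n$, with $b_{ji}=\#\{\text{arrows } j\to i\}-\#\{\text{arrows } i\to j\}$. Mutation and cluster algebras. The mutation $\mu_i(Q)$ at an exchangeable vertex $i$: add an arrow $j\to k$ for each path $j\to i\to k$; reverse all arrows incident to $i$; remove a maximal set of pairwise disjoint 2-cycles; remove arrows between frozen vertices. A seed is $(Q,\mathbf{x})$ with $\mathbf{x}=\{x_1,\dots,x_{n+m}\}$ (the cluster), initially independent indeterminates, $x_i$ attached to vertex $i$. Mutation at exchangeable $i$ replaces $Q$ by $\mu_i(Q)$ and $x_i$ by $x_i'$, where $x_ix_i'=\prod_{1\le j\le n+m,\,b_{ji}>0}x_j^{b_{ji}}+\prod_{1\le j\le n+m,\,b_{ji}<0}x_j^{-b_{ji}}$. The seeds of $\mathcal{A}_Q$ are all seeds obtained from the initial one by iterated mutation; $\mathcal{A}_Q$ is the $\mathbb{Z}$-subalgebra of $\mathbb{Q}(x_1,\dots,x_{n+m})$ generated by all elements of all clusters. A rooted cluster algebra of $\mathcal{A}$ is a triple $(Q,\mathbf{x},\mathcal{A})$ with $(Q,\mathbf{x})$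 a seed of $\mathcal{A}$. Principal coefficients. For a skew-symmetric integer $n\times n$ matrix $B$, a cluster algebra with initial exchange matrix $B^{pr}=\binom{B}{I_n}$ ($I_n$ the identity matrix) is called a cluster algebra with principal coefficients. Gluing. In an ice quiver with exchange matrix $(b_{ji})$, two frozen vertices $j,k$ are glueable if there is a positive rational number $n_{jk}$ with $b_{ji}=n_{jk}b_{ki}$ for every exchangeable vertex $i$. A frozen vertex $j$ is prime if $\gcd(b_{j1},\dots,b_{jn})=1$. The ice quiver is prime gluing free if all its frozen vertices are prime and no two distinct frozen vertices are glueable. A cluster algebra $\mathcal{A}$ is prime gluing free if there is a rooted cluster algebra $(Q,\mathbf{x},\mathcal{A})$ of $\mathcal{A}$ with $Q$ prime gluing free. *)

theory Defs
  imports
    "HOL-Library.Poly_Mapping"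
    "HOL-Computational_Algebra.Fraction_Field"
    "Jordan_Normal_Form.Matrix"
begin

section \<open>Ice quivers\<close>

text \<open>
  A quiver is recorded by its arrow multiplicities: \<open>arrows Q j k\<close> is the number of arrows
  \<open>j \<rightarrow> k\<close>. With \<open>n = num_exch Q\<close> and \<open>m = num_froz Q\<close>, the exchangeable vertices are
  \<open>0, \<dots>, n - 1\<close> and the frozen vertices are \<open>n, \<dots>, n + m - 1\<close> (counted from 0, to agree with
  the indexing of matrices and lists).
\<close>

record quiver =
  num_exch :: nat
  num_froz :: nat
  arrows :: "nat \<Rightarrow> nat \<Rightarrow> nat"

definition vertices :: "quiver \<Rightarrow> nat set" where
  "vertices Q = {..<num_exch Q + num_froz Q}"

definition exchangeable :: "quiver \<Rightarrow> nat set" where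
  "exchangeable Q = {..<num_exch Q}"

definition frozen :: "quiver \<Rightarrow> nat set" where
  "frozen Q = {num_exch Q..<num_exch Q + num_froz Q}"

definition principal_part :: "quiver \<Rightarrow> quiver" where
  "principal_part Q = \<lparr>num_exch = num_exch Q, num_froz = 0,
     arrows = (\<lambda>j k. if j \<in> exchangeable Q \<and> k \<in> exchangeable Q then arrows Q j k else 0)\<rparr>"

definition connected_quiver :: "quiver \<Rightarrow> bool" where
  "connected_quiver Q \<longleftrightarrow>
     (\<forall>v\<in>vertices Q. \<forall>w\<in>vertices Q. (v, w) \<in> {(j, k). arrows Q j k > 0 \<or> arrows Q k j > 0}\<^sup>*)"

definition ice_quiver :: "quiver \<Rightarrow> bool" where
  "ice_quiver Q \<longleftrightarrow>
     (\<forall>j k. arrows Q j k > 0 \<longrightarrow> j \<in> vertices Q \<and> k \<in> vertices Q) \<and>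
     (\<forall>j. arrows Q j j = 0) \<and>
     (\<forall>j k. arrows Q j k = 0 \<or> arrows Q k j = 0) \<and>
     (\<forall>j\<in>frozen Q. \<forall>k\<in>frozen Q. arrows Q j k = 0) \<and>
     connected_quiver Q \<and> connected_quiver (principal_part Q)"

definition exchange_matrix :: "quiver \<Rightarrow> int mat" where
  "exchange_matrix Q = mat (num_exch Q + num_froz Q) (num_exch Q)
     (\<lambda>(j, i). int (arrows Q j i) - int (arrows Q i j))"


section \<open>Mutation\<close>

text \<open>The four steps of quiver mutation, acting on arrow multiplicities.\<close>

definition add_paths :: "nat \<Rightarrow> (nat \<Rightarrow> nat \<Rightarrow> nat) \<Rightarrow> nat \<Rightarrow> nat \<Rightarrow> nat" where
  "add_paths i a j k = a j k + a j i * a i k"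

definition reverse_at :: "nat \<Rightarrow> (nat \<Rightarrow> nat \<Rightarrow> nat) \<Rightarrow> nat \<Rightarrow> nat \<Rightarrow> nat" where
  "reverse_at i a j k = (if j = i \<or> k = i then a k j else a j k)"

definition cancel_2cycles :: "(nat \<Rightarrow> nat \<Rightarrow> nat) \<Rightarrow> nat \<Rightarrow> nat \<Rightarrow> nat" where
  "cancel_2cycles a j k = a j k - min (a j k) (a k j)"

definition remove_between :: "nat set \<Rightarrow> (nat \<Rightarrow> nat \<Rightarrow> nat) \<Rightarrow> nat \<Rightarrow> nat \<Rightarrow> nat" where
  "remove_between F a j k = (if j \<in> F \<and> k \<in> F then 0 else a j k)"

definition mutate_quiver :: "nat \<Rightarrow> quiver \<Rightarrow> quiver" where
  "mutate_quiver i Q = Q\<lparr>arrows :=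
     remove_between (frozen Q) (cancel_2cycles (reverse_at i (add_paths i (arrows Q))))\<rparr>"

text \<open>
  Rational functions over \<open>\<rat>\<close> in indeterminates indexed by the natural numbers. For a quiver with
  \<open>N\<close> vertices only the indeterminates with index below \<open>N\<close> are used, so that everything below
  takes place in the subfield \<open>\<rat>(x\<^sub>0, \<dots>, x\<^sub>N\<^sub>-\<^sub>1)\<close>.
\<close>

type_synonym ratfun = "((nat \<Rightarrow>\<^sub>0 nat) \<Rightarrow>\<^sub>0 rat) fract"

definition indet :: "nat \<Rightarrow> ratfun" where
  "indet i = Fraction_Field.Fract (Poly_Mapping.single (Poly_Mapping.single i 1) 1) 1"

text \<open>The cluster of a seed is a list whose \<open>j\<close>-th entry is attached to the vertex \<open>j\<close>.\<close>

type_synonym seed = "quiver \<times> ratfun list"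

definition initial_seed :: "quiver \<Rightarrow> seed" where
  "initial_seed Q = (Q, map indet [0..<num_exch Q + num_froz Q])"

definition exchange_rhs :: "nat \<Rightarrow> quiver \<Rightarrow> ratfun list \<Rightarrow> ratfun" where
  "exchange_rhs i Q xs = (let b = (\<lambda>j. exchange_matrix Q $$ (j, i)) in
     (\<Prod>j | j \<in> vertices Q \<and> b j > 0. (xs ! j) ^ nat (b j)) +
     (\<Prod>j | j \<in> vertices Q \<and> b j < 0. (xs ! j) ^ nat (- b j)))"

text \<open>
  The exchange relation \<open>x\<^sub>i x\<^sub>i' = exchange_rhs\<close> is solved for \<open>x\<^sub>i'\<close>; cluster elements are
  never zero, so the quotient is a genuine one.
\<close>

definition mutate_seed :: "nat \<Rightarrow> seed \<Rightarrow> seed" where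
  "mutate_seed i = (\<lambda>(Q, xs). (mutate_quiver i Q, xs[i := exchange_rhs i Q xs / xs ! i]))"

inductive_set seeds_from :: "quiver \<Rightarrow> seed set" for Q\<^sub>0 :: quiver where
  initial: "initial_seed Q\<^sub>0 \<in> seeds_from Q\<^sub>0"
| mutation: "(Q, xs) \<in> seeds_from Q\<^sub>0 \<Longrightarrow> i \<in> exchangeable Q \<Longrightarrow>
    mutate_seed i (Q, xs) \<in> seeds_from Q\<^sub>0"


section \<open>Cluster algebras\<close>

text \<open>A \<open>\<int>\<close>-subalgebra of a commutative ring is the same as a unital subring.\<close>

definition int_subalgebra :: "'a::comm_ring_1 set \<Rightarrow> bool" where
  "int_subalgebra R \<longleftrightarrow>
     1 \<in> R \<and> (\<forall>a\<in>R. \<forall>b\<in>R. a - b \<in> R) \<and> (\<forall>a\<in>R. \<forall>b\<in>R. a * b \<in> R)"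

text \<open>A cluster algebra is the subring together with its collection of seeds.\<close>

record cluster_alg =
  ca_carrier :: "ratfun set"
  ca_seeds :: "seed set"

definition cluster_algebra_of :: "quiver \<Rightarrow> cluster_alg" where
  "cluster_algebra_of Q = \<lparr>
     ca_carrier = int_subalgebra hull (\<Union>(Q', xs)\<in>seeds_from Q. set xs),
     ca_seeds = seeds_from Q\<rparr>"

definition cluster_algebra :: "cluster_alg \<Rightarrow> bool" where
  "cluster_algebra A \<longleftrightarrow> (\<exists>Q. ice_quiver Q \<and> A = cluster_algebra_of Q)"

definition rooted_cluster_algebra :: "quiver \<Rightarrow> ratfun list \<Rightarrow> cluster_alg \<Rightarrow> bool" where
  "rooted_cluster_algebra Q xs A \<longleftrightarrow> cluster_algebra A \<and> (Q, xs) \<in> ca_seeds A"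

definition principal_matrix :: "int mat \<Rightarrow> int mat" where
  "principal_matrix B = B @\<^sub>r 1\<^sub>m (dim_row B)"

definition has_principal_coefficients :: "cluster_alg \<Rightarrow> bool" where
  "has_principal_coefficients A \<longleftrightarrow>
     (\<exists>n B Q. B \<in> carrier_mat n n \<and> transpose_mat B = - B \<and>
        ice_quiver Q \<and> exchange_matrix Q = principal_matrix B \<and> A = cluster_algebra_of Q)"


section \<open>Gluing\<close>

definition glueable :: "quiver \<Rightarrow> nat \<Rightarrow> nat \<Rightarrow> bool" where
  "glueable Q j k \<longleftrightarrow> j \<in> frozen Q \<and> k \<in> frozen Q \<and>
     (\<exists>c::rat. c > 0 \<and> (\<forall>i\<in>exchangeable Q.
        of_int (exchange_matrix Q $$ (j, i)) = c * of_int (exchange_matrix Q $$ (k, i))))"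

definition prime_vertex :: "quiver \<Rightarrow> nat \<Rightarrow> bool" where
  "prime_vertex Q j \<longleftrightarrow>
     j \<in> frozen Q \<and> Gcd ((\<lambda>i. exchange_matrix Q $$ (j, i)) ` exchangeable Q) = 1"

definition prime_gluing_free_quiver :: "quiver \<Rightarrow> bool" where
  "prime_gluing_free_quiver Q \<longleftrightarrow>
     (\<forall>j\<in>frozen Q. prime_vertex Q j) \<and>
     (\<forall>j\<in>frozen Q. \<forall>k\<in>frozen Q. j \<noteq> k \<longrightarrow> \<not> glueable Q j k)"

definition prime_gluing_free :: "cluster_alg \<Rightarrow> bool" where
  "prime_gluing_free A \<longleftrightarrow>
     (\<exists>Q xs. rooted_cluster_algebra Q xs A \<and> prime_gluing_free_quiver Q)"

end

theory Submission
  imports Defs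
begin

text \<open>
  The initial seed already works: each frozen row of the matrix \<open>principal_matrix B\<close> is a unit
  vector, whence its gcd is 1, and distinct unit vectors are never proportional.
\<close>

lemma principal_matrix_lower_row:
  assumes "B \<in> carrier_mat n n" "n \<le> j" "j < n + n" "i < n"
  shows "principal_matrix B $$ (j, i) = (if i = j - n then 1 else 0)"
  using assms by (auto simp: principal_matrix_def append_rows_def)

lemma prime_gluing_free_quiver_principal:
  assumes B: "B \<in> carrier_mat n n" and E: "exchange_matrix Q = principal_matrix B"
  shows "prime_gluing_free_quiver Q"
proof -
  \<comment> \<open>The hypotheses speak of \<open>Q\<close> only through its exchange matrix, so
    the two vertex counts are recovered from the dimensions of that matrix: both equal
    \<open>n\<close>.\<close>
  have "dim_row (exchange_matrix Q) = n + n" "dim_col (exchange_matrix Q) = n"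
    using B by (auto simp: E principal_matrix_def append_rows_def)
  then have exch: "exchangeable Q = {..<n}" and froz: "frozen Q = {n..<n + n}"
    by (auto simp: exchange_matrix_def exchangeable_def frozen_def)
  have entry: "exchange_matrix Q $$ (j, i) = (if i = j - n then 1 else 0)"
    if "j \<in> frozen Q" "i \<in> exchangeable Q" for j i
    using that principal_matrix_lower_row[OF B] by (simp add: E exch froz)
  have col: "j - n \<in> exchangeable Q" if "j \<in> frozen Q" for j
    using that by (auto simp: exch froz)
  have "prime_vertex Q j" if j: "j \<in> frozen Q" for j
  proof -
    have "1 \<in> (\<lambda>i. exchange_matrix Q $$ (j, i)) ` exchangeable Q"
      using entry[OF j col[OF j]] col[OF j] by force
    then have "Gcd ((\<lambda>i. exchange_matrix Q $$ (j, i)) ` exchangeable Q) = 1"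
      by (rule Gcd_eq_1_I[rotated]) simp
    with j show ?thesis by (simp add: prime_vertex_def)
  qed
  moreover have "\<not> glueable Q j k" if j: "j \<in> frozen Q" and k: "k \<in> frozen Q" and "j \<noteq> k" for j k
  proof
    assume "glueable Q j k"
    \<comment> \<open>At column \<open>j - n\<close> the proportionality of rows \<open>j\<close>
      and \<open>k\<close> will read 1 = c * 0.\<close>
    then obtain c :: rat where "of_int (exchange_matrix Q $$ (j, j - n)) =
        c * of_int (exchange_matrix Q $$ (k, j - n))"
      using col[OF j] by (auto simp: glueable_def)
    \<comment> \<open>Truncated subtraction keeps \<open>j\<close> and \<open>k\<close> apart
      because both are at least \<open>n\<close>.\<close>
    moreover have "j - n \<noteq> k - n"
      using j k \<open>j \<noteq> k\<close> by (auto simp: froz)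
    ultimately show False
      using entry[OF j col[OF j]] entry[OF k col[OF j]] by simp
  qed
  ultimately show ?thesis by (simp add: prime_gluing_free_quiver_def)
qed

theorem proposition3p8:
  fixes A :: cluster_alg
  assumes "has_principal_coefficients A"
  shows "prime_gluing_free A"
proof -
  obtain n B Q where B: "B \<in> carrier_mat n n" "exchange_matrix Q = principal_matrix B"
    and Q: "ice_quiver Q" "A = cluster_algebra_of Q"
    using assms by (auto simp: has_principal_coefficients_def)
  \<comment> \<open>The root is the initial seed, whose exchange matrix is the one given by the
    hypothesis.\<close>
  have "(Q, map indet [0..<num_exch Q + num_froz Q]) \<in> seeds_from Q"
    using seeds_from.initial[of Q] by (simp add: initial_seed_def)
  with Q have "rooted_cluster_algebra Q (map indet [0..<num_exch Q + num_froz Q]) A"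
    by (auto simp: rooted_cluster_algebra_def cluster_algebra_def cluster_algebra_of_def)
  with prime_gluing_free_quiver_principal[OF B] show ?thesis
    unfolding prime_gluing_free_def by blast
qed

end
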